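(* The hypergraph $S_4^{8}$ with vertex set $V_4^{8}=\{v_1,\dots,v_8\}$ and the explicitly listed hyperedge set $E_4^{8}$ (given in the context) is a Steiner system $S(3,4,8)$: every hyperedge has exactly $4$ vertices, and every $3$-element subset of $V_4^{8}$ is contained in exactly one hyperedge. Moreover, $E_4^{8}$ consists of exactly $14$ hyperedges.
   Context: A Steiner system $S(t,k,n)$ is a set $V$ of $n$ points together with a collection of $k$-element subsets of $V$ (blocks) such that every $t$-element subset of $V$ is contained in exactly one block. It is regarded as a $k$-uniform hypergraph whose hyperedges are the blocks. Definition of $E_4^{8}$. The complementary hyperedge of a $4$-subset $e\subset V_4^{8}$ is $V_4^{8}\setminus e$. The set $E_4^{8}$ consists of all the $4$-subsets in (1)-(2) below together with the complementary hyperedge of each of them. (1) $\{v_1,v_2,v_3,v_4\}$. (2) All sets $A\cup p$ with $p\in B$, where $(A,B)$ is one of the three pairs: $A=\{v_1,v_2\}$, $B=\{\{v_5,v_6\},\{v_7,v_8\}\}$; $A=\{v_1,v_3\}$, $B=\{\{v_5,v_7\},\{v_6,v_8\}\}$; $A=\{v_1,v_4\}$, $B=\{\{v_5,v_8\},\{v_6,v_7\}\}$. *)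

theory Defs
  imports Main
begin

type_synonym 'a hypergraph = "'a set \<times> 'a set set"

definition steiner_system :: "nat \<Rightarrow> nat \<Rightarrow> nat \<Rightarrow> 'a hypergraph \<Rightarrow> bool" where
  "steiner_system t k n H \<longleftrightarrow>
     (case H of (V, E) \<Rightarrow>
        finite V \<and> card V = n \<and>
        (\<forall>e\<in>E. e \<subseteq> V \<and> card e = k) \<and>
        (\<forall>T. T \<subseteq> V \<and> card T = t \<longrightarrow> (\<exists>!e. e \<in> E \<and> T \<subseteq> e)))"

datatype vertex = v1 | v2 | v3 | v4 | v5 | v6 | v7 | v8

definition V48 :: "vertex set" where
  "V48 = {v1, v2, v3, v4, v5, v6, v7, v8}"

definition complementary_hyperedge :: "vertex set \<Rightarrow> vertex set" where
  "complementary_hyperedge e = V48 - e"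

definition pairs48 :: "(vertex set \<times> vertex set set) set" where
  "pairs48 =
     {({v1, v2}, {{v5, v6}, {v7, v8}}),
      ({v1, v3}, {{v5, v7}, {v6, v8}}),
      ({v1, v4}, {{v5, v8}, {v6, v7}})}"

definition base48 :: "vertex set set" where
  "base48 = {{v1, v2, v3, v4}} \<union> {A \<union> p | A B p. (A, B) \<in> pairs48 \<and> p \<in> B}"

definition E48 :: "vertex set set" where
  "E48 = base48 \<union> complementary_hyperedge ` base48"

definition S48 :: "vertex hypergraph" where
  "S48 = (V48, E48)"

end

theory Submission
  imports Defs
begin

text \<open>Once \<open>E48\<close> is written out as an explicit list, everything is a finite
  check. Existence: each of the finitely many triples lies in some listed block
  (\<open>triple_in_hyperedge\<close>). Uniqueness: distinct blocks share fewer than three points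
  (\<open>card_Int_hyperedges\<close>), so no triple fits into two of them. As \<open>V48\<close> is
  the whole type, the inclusions in \<open>V48\<close> are trivial.\<close>

lemma V48_UNIV: "V48 = UNIV"
proof -
  have "x \<in> V48" for x
    by (cases x) (simp_all add: V48_def)
  then show ?thesis by blast
qed

lemma base48_eq:
  "base48 = {{v1, v2, v3, v4}, {v1, v2, v5, v6}, {v1, v2, v7, v8}, {v1, v3, v5, v7},
     {v1, v3, v6, v8}, {v1, v4, v5, v8}, {v1, v4, v6, v7}}"
proof -
  \<comment> \<open>As a union of images over explicit finite sets, the comprehension can be
    evaluated by the simplifier.\<close>
  have "{A \<union> p | A B p. (A, B) \<in> pairs48 \<and> p \<in> B} = (\<Union>(A, B)\<in>pairs48. (\<union>) A ` B)"
    by blast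
  then show ?thesis
    by (simp add: base48_def pairs48_def insert_commute)
qed

text \<open>The last seven sets are the complements of the first seven, in the same order.\<close>

lemma E48_eq:
  "E48 = {{v1, v2, v3, v4}, {v1, v2, v5, v6}, {v1, v2, v7, v8}, {v1, v3, v5, v7},
     {v1, v3, v6, v8}, {v1, v4, v5, v8}, {v1, v4, v6, v7},
     {v5, v6, v7, v8}, {v3, v4, v7, v8}, {v3, v4, v5, v6}, {v2, v4, v6, v8},
     {v2, v4, v5, v7}, {v2, v3, v6, v7}, {v2, v3, v5, v8}}"
  unfolding E48_def base48_eq
  by (simp add: complementary_hyperedge_def V48_def insert_Diff_if insert_commute)

lemma card_E48: "card E48 = 14"
  \<comment> \<open>Splitting equality into two inclusions lets the simplifier tell the listed sets
    apart by their members.\<close>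
  by (simp add: E48_eq set_eq_subset)

lemma card_hyperedge: "e \<in> E48 \<Longrightarrow> card e = 4"
  by (auto simp: E48_eq)

text \<open>Checked on all pairs from the list; this is the uniqueness half of the Steiner
  property.\<close>

lemma card_Int_hyperedges:
  assumes "e \<in> E48" and "f \<in> E48" and "e \<noteq> f"
  shows "card (e \<inter> f) < 3"
proof -
  have "\<forall>e\<in>E48. \<forall>f\<in>E48. e = f \<or> card (e \<inter> f) < 3"
    by (simp add: E48_eq)
  with assms show ?thesis by blast
qed

lemma triple_in_hyperedge:
  assumes "a \<noteq> b" and "a \<noteq> c" and "b \<noteq> c"
  shows "\<exists>e\<in>E48. {a, b, c} \<subseteq> e"
  using assms unfolding E48_eq by (cases a; cases b; cases c) simp_all

theorem mainTheorem2:
  shows "steiner_system 3 4 8 S48 \<and> card E48 = 14"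
proof -
  have "\<exists>!e. e \<in> E48 \<and> T \<subseteq> e" if "card T = 3" for T
  proof -
    obtain a b c where "T = {a, b, c}" "a \<noteq> b" "a \<noteq> c" "b \<noteq> c"
      using \<open>card T = 3\<close> by (auto simp: card_3_iff)
    then obtain e where e: "e \<in> E48" "T \<subseteq> e"
      using triple_in_hyperedge by blast
    moreover have "f = e" if f: "f \<in> E48" "T \<subseteq> f" for f
    proof (rule ccontr)
      assume "f \<noteq> e"
      with e f have "card (f \<inter> e) < 3"
        by (simp add: card_Int_hyperedges)
      \<comment> \<open>Finiteness, needed for monotonicity of \<open>card\<close>, follows from
        \<open>card e = 4\<close> being positive.\<close>
      moreover have "finite (f \<inter> e)"
        using card_hyperedge[OF \<open>e \<in> E48\<close>] by (simp add: card_ge_0_finite)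
      then have "card T \<le> card (f \<inter> e)"
        using e f by (intro card_mono) auto
      ultimately show False using \<open>card T = 3\<close> by simp
    qed
    ultimately show ?thesis by blast
  qed
  moreover have "finite V48" "card V48 = 8"
    by (simp_all add: V48_def)
  ultimately show ?thesis
    by (simp add: steiner_system_def S48_def card_hyperedge card_E48 V48_UNIV)
qed

end
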